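(* The projective general linear group $\mathrm{PGL}(2,9)$ is nonrecognizable, i.e. $h(\mathrm{PGL}(2,9))=\infty$: there are infinitely many pairwise non-isomorphic finite groups $H$ with $\omega(H)=\omega(\mathrm{PGL}(2,9))$.
   Context: All groups are finite. For a group $G$, the spectrum $\omega(G)$ is the set of orders of all elements of $G$. $h(G)$ denotes the number of isomorphism classes of finite groups $H$ with $\omega(H)=\omega(G)$ (with $h(G)=\infty$ if there are infinitely many). A group $G$ is called nonrecognizable if $h(G)=\infty$. $\mathrm{PGL}(2,9)$ is the projective general linear group of degree 2 over the field with 9 elements. *)

theory Defs
  imports
    "HOL-Algebra.Coset"
    "HOL-Algebra.Multiplicative_Group"
    "HOL-Analysis.Determinants"
    "HOL-Library.Extended_Nat"
    "HOL-Library.Numeral_Type"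
begin

definition spectrum :: "('a, 'b) monoid_scheme \<Rightarrow> nat set" where
  "spectrum G = {group.ord G x |x. x \<in> carrier G}"

text \<open>
  Every finite group has an isomorphic copy whose elements are natural numbers
  (lemma \<open>finite_group_iso_nat\<close> below), so groups on subsets of \<^typ>\<open>nat\<close> represent all
  isomorphism classes of finite groups.
\<close>

definition isospectral_groups :: "('a, 'b) monoid_scheme \<Rightarrow> nat monoid set" where
  "isospectral_groups G = {H. group H \<and> finite (carrier H) \<and> spectrum H = spectrum G}"

definition isospectral_classes :: "('a, 'b) monoid_scheme \<Rightarrow> nat monoid set set" where
  "isospectral_classes G =
     isospectral_groups G //
       {(H, K). H \<in> isospectral_groups G \<and> K \<in> isospectral_groups G \<and> H \<cong> K}"

definition num_isospectral :: "('a, 'b) monoid_scheme \<Rightarrow> enat" where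
  "num_isospectral G =
     (if finite (isospectral_classes G) then enat (card (isospectral_classes G)) else \<infinity>)"

definition nonrecognizable :: "('a, 'b) monoid_scheme \<Rightarrow> bool" where
  "nonrecognizable G \<longleftrightarrow> num_isospectral G = \<infinity>"

definition GL :: "('a::field ^ 'n ^ 'n) monoid" where
  "GL = \<lparr>carrier = {A. invertible A}, monoid.mult = (**), one = mat 1\<rparr>"

definition PGL :: "('a::field ^ 'n ^ 'n) set monoid" where
  "PGL = GL Mod {mat c |c. c \<noteq> 0}"

lemma finite_group_iso_nat:
  fixes G :: "('a, 'b) monoid_scheme" (structure)
  assumes "group G" and fin: "finite (carrier G)"
  shows "\<exists>H :: nat monoid. group H \<and> G \<cong> H"
proof -
  interpret group G by fact
  obtain f :: "'a \<Rightarrow> nat" where f: "inj_on f (carrier G)"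
    using finite_imp_inj_to_nat_seg[OF fin] by blast
  define g where "g = inv_into (carrier G) f"
  define H where "H = \<lparr>carrier = f ` carrier G, monoid.mult = (\<lambda>x y. f (g x \<otimes> g y)), one = f \<one>\<rparr>"
  have g [simp]: "g (f x) = x" if "x \<in> carrier G" for x
    using f that by (simp add: g_def)
  have mult_H: "f a \<otimes>\<^bsub>H\<^esub> f b = f (a \<otimes> b)"
    if "a \<in> carrier G" "b \<in> carrier G" for a b
    using that by (simp add: H_def)
  have carrier_H: "carrier H = f ` carrier G" and one_H: "\<one>\<^bsub>H\<^esub> = f \<one>"
    by (simp_all add: H_def)
  have "group H"
  proof (rule groupI, unfold carrier_H one_H)
    fix x assume "x \<in> f ` carrier G"
    then obtain a where "a \<in> carrier G" "x = f a" by blast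
    then show "\<exists>y\<in>f ` carrier G. y \<otimes>\<^bsub>H\<^esub> x = f \<one>"
      by (intro bexI[of _ "f (inv a)"]) (simp_all add: mult_H)
  qed (auto simp: mult_H m_assoc)
  moreover have "f \<in> iso G H"
    using f by (simp add: iso_def hom_def bij_betw_def carrier_H mult_H)
  ultimately show ?thesis
    using is_isoI by blast
qed

lemma invertible_mat_1: "invertible (mat 1 :: 'a::field ^ 'n ^ 'n)"
  unfolding invertible_def by (rule exI[of _ "mat 1"]) simp

lemma group_GL: "group (GL :: ('a::field ^ 'n ^ 'n) monoid)"
proof (rule groupI)
  fix A :: "'a ^ 'n ^ 'n"
  assume "A \<in> carrier GL"
  then obtain B where "A ** B = mat 1" "B ** A = mat 1"
    unfolding GL_def invertible_def by auto
  then show "\<exists>B\<in>carrier GL. B \<otimes>\<^bsub>GL\<^esub> A = \<one>\<^bsub>GL\<^esub>"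
    unfolding GL_def invertible_def by (intro bexI[of _ B]) auto
qed (simp_all add: GL_def matrix_mul_assoc invertible_mult invertible_mat_1)

lemma mat_mult_nth: "(mat c ** A) $ i $ j = c * (A $ i $ j :: 'a::field)"
proof -
  have "(mat c ** A) $ i $ j = (\<Sum>k\<in>UNIV. if k = i then c * A $ k $ j else 0)"
    unfolding matrix_matrix_mult_def mat_def vec_lambda_beta by (rule sum.cong) auto
  then show ?thesis by simp
qed

lemma mult_mat_nth: "(A ** mat c) $ i $ j = c * (A $ i $ j :: 'a::field)"
proof -
  have "(A ** mat c) $ i $ j = (\<Sum>k\<in>UNIV. if k = j then c * A $ i $ k else 0)"
    unfolding matrix_matrix_mult_def mat_def vec_lambda_beta by (rule sum.cong) auto
  then show ?thesis by simp
qed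

lemma mat_mult_eq: "mat c ** A = A ** (mat c :: 'a::field ^ 'n ^ 'n)"
  by (simp add: vec_eq_iff mat_mult_nth mult_mat_nth)

lemma mat_mult_mat: "mat c ** mat d = (mat (c * d) :: 'a::field ^ 'n ^ 'n)"
  by (simp add: vec_eq_iff mat_mult_nth) (simp add: mat_def)

lemma normal_scalars: "{mat c |c. c \<noteq> 0} \<lhd> (GL :: ('a::field ^ 'n ^ 'n) monoid)"
proof -
  interpret GL: group "GL :: ('a ^ 'n ^ 'n) monoid" by (rule group_GL)
  let ?Z = "{mat c |c. c \<noteq> 0} :: ('a ^ 'n ^ 'n) set"
  have inverse: "mat c ** mat (inverse c) = (mat 1 :: 'a ^ 'n ^ 'n)"
      "mat (inverse c) ** mat c = (mat 1 :: 'a ^ 'n ^ 'n)" if "c \<noteq> 0" for c :: 'a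
    using that by (simp_all add: mat_mult_mat)
  have carr: "mat c \<in> carrier (GL :: ('a ^ 'n ^ 'n) monoid)" if "c \<noteq> 0" for c
    using inverse[OF that]
    unfolding GL_def invertible_def by (auto intro!: exI[of _ "mat (inverse c)"])
  have inv_mat: "inv\<^bsub>GL\<^esub> (mat c) = (mat (inverse c) :: 'a ^ 'n ^ 'n)" if "c \<noteq> 0" for c
    using inverse[OF that] carr[OF that] carr[of "inverse c"] that
    by (intro GL.inv_equality) (auto simp: GL_def)
  have "subgroup ?Z GL"
  proof (rule GL.subgroupI)
    show "?Z \<noteq> {}" using zero_neq_one[where 'a='a, symmetric] by blast
  next
    fix a b assume "a \<in> ?Z" "b \<in> ?Z"
    then obtain c d where "a = mat c" "c \<noteq> 0" "b = mat d" "d \<noteq> 0" by blast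
    then have "a \<otimes>\<^bsub>GL\<^esub> b = mat (c * d)" "c * d \<noteq> 0"
      by (simp_all add: GL_def mat_mult_mat)
    then show "a \<otimes>\<^bsub>GL\<^esub> b \<in> ?Z" by blast
  next
    fix a assume "a \<in> ?Z"
    then obtain c where "a = mat c" "c \<noteq> 0" by blast
    then have "inv\<^bsub>GL\<^esub> a = mat (inverse c)" "inverse c \<noteq> 0"
      by (simp_all add: inv_mat)
    then show "inv\<^bsub>GL\<^esub> a \<in> ?Z" by blast
  qed (use carr in blast)
  moreover have "x \<otimes>\<^bsub>GL\<^esub> h \<otimes>\<^bsub>GL\<^esub> inv\<^bsub>GL\<^esub> x \<in> ?Z" if x: "x \<in> carrier GL" and h: "h \<in> ?Z" for x h
  proof -
    obtain c where c: "h = mat c" "c \<noteq> 0" using h by blast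
    have "x \<otimes>\<^bsub>GL\<^esub> h = h \<otimes>\<^bsub>GL\<^esub> x"
      by (simp add: c GL_def mat_mult_eq[of c x])
    moreover have "h \<in> carrier GL" using c carr by simp
    ultimately have "x \<otimes>\<^bsub>GL\<^esub> h \<otimes>\<^bsub>GL\<^esub> inv\<^bsub>GL\<^esub> x = h"
      using x by (simp add: GL.m_assoc)
    then show ?thesis using h by (simp only:)
  qed
  ultimately show ?thesis
    unfolding GL.normal_inv_iff by blast
qed

lemma group_PGL: "group (PGL :: ('a::field ^ 'n ^ 'n) set monoid)"
  unfolding PGL_def by (rule normal.factorgroup_is_group[OF normal_scalars])

end

theory Submission
  imports Defs "HOL-Computational_Algebra.Polynomial" "HOL-Number_Theory.Residues"
begin

text \<open>
  The orders of the elements of \<open>PGL(2,9)\<close> are the divisors of \<open>3\<close>, \<open>8\<close> and \<open>10\<close>, that is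
  \<open>{1, 2, 3, 4, 5, 8, 10}\<close>: the three numbers belong to the unipotent elements, the split torus
  and the non-split torus. The same spectrum occurs for groups of unbounded size. In these, an
  elementary abelian \<open>3\<close>-group \<open>V\<close> is extended by a group \<open>T\<close> of linear maps of \<open>V\<close> in which
  only the identity fixes a nonzero vector. If \<open>g \<noteq> 1\<close> and \<open>g\<close> has order \<open>n\<close>, then
  \<open>v + g v + \<dots> + g\<^bsup>n - 1\<^esup> v\<close> is fixed by \<open>g\<close>, hence zero, so every affine map with linear
  part \<open>g\<close> has order \<open>n\<close> as well. Translations have order \<open>1\<close> or \<open>3\<close>. The spectrum of the
  extension is therefore the spectrum of \<open>T\<close> together with \<open>3\<close>, and it stays the same when \<open>V\<close>
  is replaced by any power \<open>V\<^bsup>k\<^esup>\<close> with \<open>k > 0\<close>.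

  It remains to find \<open>T\<close> with element orders the divisors of \<open>8\<close> and \<open>10\<close>. Let \<open>V\<close> be
  the field \<open>\<int>[\<zeta>]/3\<close> with \<open>81\<close> elements, \<open>\<zeta>\<close> a primitive fifth root of unity, and let
  \<open>\<sigma>\<close> be its automorphism with \<open>\<sigma> \<zeta> = \<zeta>\<^bsup>3\<^esup>\<close>. Then \<open>T\<close> is generated by multiplication with
  \<open>\<zeta>\<close> and by the map \<open>b x = (1 - \<zeta>) \<cdot> \<sigma> x\<close>. The fourth power of \<open>b\<close> is multiplication with the
  norm of \<open>1 - \<zeta>\<close>, which is \<open>5 = -1\<close>, so \<open>b\<close> has order \<open>8\<close> and \<open>T\<close> is a semidirect product of
  cyclic groups of orders \<open>5\<close> and \<open>8\<close>. Every element of \<open>T\<close> is a power of \<open>\<zeta>\<close> or has \<open>-1\<close>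
  among its powers (\<open>frobenius_complement_cases\<close>), which gives both the element orders and
  the absence of fixed vectors.

  The spectrum of \<open>PGL(2,9)\<close> itself is computed without diagonalisation: by
  Cayley-Hamilton, \<open>A\<^bsup>n\<^esup>\<close> is scalar as soon as the \<open>n\<close>-th Lucas polynomial
  \<open>U\<^sub>n\<close> vanishes at the trace \<open>t\<close> and determinant \<open>d\<close> of \<open>A\<close>, and in a field with nine
  elements \<open>U\<^sub>3 = t\<^sup>2 - d\<close> while \<open>U\<^sub>8 U\<^sub>1\<^sub>0 = (t\<^sup>2 - d)\<^bsup>8\<^esup> - 1\<close>, so that one
  of the three factors always vanishes (\<open>lucas_U_vanishes\<close>).
\<close>

section \<open>Spectra and isomorphism classes\<close>

lemma (in group) spectrum_3_8_10I:
  assumes exponents: "\<And>x. x \<in> carrier G \<Longrightarrow> x [^] (3::nat) = \<one> \<or> x [^] (8::nat) = \<one> \<or> x [^] (10::nat) = \<one>"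
    and x: "x \<in> carrier G" "x [^] (3::nat) = \<one>" "x \<noteq> \<one>"
    and y: "y \<in> carrier G" "y [^] (8::nat) = \<one>" "y [^] (4::nat) \<noteq> \<one>"
    and z: "z \<in> carrier G" "z [^] (10::nat) = \<one>" "z [^] (5::nat) \<noteq> \<one>" "z [^] (2::nat) \<noteq> \<one>"
  shows "spectrum G = {1, 2, 3, 4, 5, 8, 10}"
proof
  have small: "d = 1 \<or> d = 2 \<or> d = 3 \<or> d = 4 \<or> d = 5 \<or> d = 6 \<or> d = 7 \<or> d = 8 \<or> d = 9 \<or> d = 10"
    if "d dvd 3 \<or> d dvd 8 \<or> d dvd 10" for d :: nat
  proof -
    have "d \<noteq> 0" using that by (metis dvd_0_left_iff zero_neq_numeral)
    moreover have "d \<le> 10" using that by (auto dest: dvd_imp_le)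
    ultimately show ?thesis by presburger
  qed
  show "spectrum G \<subseteq> {1, 2, 3, 4, 5, 8, 10}"
  proof
    fix d assume "d \<in> spectrum G"
    then obtain g where "g \<in> carrier G" "d = ord g" by (auto simp: spectrum_def)
    then have "d dvd 3 \<or> d dvd 8 \<or> d dvd 10"
      using exponents[of g] by (simp add: pow_eq_id)
    with small[OF this] show "d \<in> {1, 2, 3, 4, 5, 8, 10}"
      by (elim disjE) simp_all
  qed
  have "ord x = 3" using x small[of "ord x"] ord_eq_1[of x] by (auto simp: pow_eq_id)
  moreover have y8: "ord y = 8" using y small[of "ord y"] by (auto simp: pow_eq_id)
  moreover have z10: "ord z = 10" using z small[of "ord z"] by (auto simp: pow_eq_id)
  moreover have "ord \<one> = 1" "ord (y [^] (4::nat)) = 2" "ord (y [^] (2::nat)) = 4" "ord (z [^] (2::nat)) = 5"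
    using y(1) z(1) by (simp_all add: ord_pow y8 z10)
  moreover have "ord g \<in> spectrum G" if "g \<in> carrier G" for g
    using that by (auto simp: spectrum_def)
  ultimately show "{1, 2, 3, 4, 5, 8, 10} \<subseteq> spectrum G"
    using x(1) y(1) z(1) one_closed nat_pow_closed by (metis insert_subset empty_subsetI)
qed

lemma spectrum_iso:
  assumes "group G" "group H" "G \<cong> H"
  shows "spectrum G = spectrum H"
proof -
  interpret G: group G by fact
  interpret H: group H by fact
  obtain f where f: "f \<in> hom G H" "bij_betw f (carrier G) (carrier H)"
    using assms(3) by (auto simp: is_iso_def iso_def)
  interpret group_hom G H f by unfold_locales fact
  have "H.ord (f x) = G.ord x" if x: "x \<in> carrier G" for x
  proof -
    have "f x [^]\<^bsub>H\<^esub> n = \<one>\<^bsub>H\<^esub> \<longleftrightarrow> x [^]\<^bsub>G\<^esub> n = \<one>\<^bsub>G\<^esub>" for n :: nat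
    proof -
      have "f x [^]\<^bsub>H\<^esub> n = \<one>\<^bsub>H\<^esub> \<longleftrightarrow> f (x [^]\<^bsub>G\<^esub> n) = f \<one>\<^bsub>G\<^esub>"
        using x by (simp add: hom_nat_pow)
      also have "\<dots> \<longleftrightarrow> x [^]\<^bsub>G\<^esub> n = \<one>\<^bsub>G\<^esub>"
        using f(2) x by (intro inj_on_eq_iff[of f "carrier G"]) (auto simp: bij_betw_def)
      finally show ?thesis .
    qed
    then show ?thesis
      using x by (simp add: H.ord_unique G.pow_eq_id)
  qed
  moreover have "carrier H = f ` carrier G"
    using f by (simp add: bij_betw_def)
  ultimately show ?thesis
    by (simp add: spectrum_def Setcompr_eq_image image_image cong: image_cong)
qed

text \<open>
  The orders of the groups separate isomorphism classes, so an isospectral family with pairwise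
  different orders suffices; it is moved to \<^typ>\<open>nat\<close> only to meet the definition.
\<close>

lemma nonrecognizableI:
  fixes H :: "nat \<Rightarrow> 'b monoid"
  assumes "\<And>k. group (H k)" "\<And>k. finite (carrier (H k))"
    and spec: "\<And>k. spectrum (H k) = spectrum G"
    and inj: "inj (\<lambda>k. card (carrier (H k)))"
  shows "nonrecognizable G"
proof -
  have "\<exists>N :: nat monoid. group N \<and> H k \<cong> N" for k
    by (rule finite_group_iso_nat) fact+
  then obtain N :: "nat \<Rightarrow> nat monoid" where N: "\<And>k. group (N k)" "\<And>k. H k \<cong> N k"
    by metis
  have card_N: "card (carrier (N k)) = card (carrier (H k))" for k
    using iso_same_card[OF N(2)] by simp
  have "finite (carrier (N k))" for k
  proof -
    obtain f where "bij_betw f (carrier (H k)) (carrier (N k))"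
      using N(2)[of k] by (auto simp: is_iso_def iso_def)
    then show ?thesis using assms(2) bij_betw_finite by blast
  qed
  then have N_iso: "N k \<in> isospectral_groups G" for k
    using N assms by (simp add: isospectral_groups_def flip: spec spectrum_iso[OF assms(1) N])
  let ?R = "{(H, K). H \<in> isospectral_groups G \<and> K \<in> isospectral_groups G \<and> H \<cong> K}"
  have "inj (\<lambda>k. ?R `` {N k})"
  proof (rule injI)
    fix k l assume eq: "?R `` {N k} = ?R `` {N l}"
    have "N k \<cong> N k"
      using iso_set_refl by (auto simp: is_iso_def)
    then have "N k \<in> ?R `` {N k}"
      using N_iso by simp
    then have "N l \<cong> N k"
      unfolding eq by simp
    then have "card (carrier (H l)) = card (carrier (H k))"
      using iso_same_card card_N by metis
    then show "k = l"
      using injD[OF inj] by metis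
  qed
  moreover have "range (\<lambda>k. ?R `` {N k}) \<subseteq> isospectral_classes G"
    unfolding isospectral_classes_def by (intro image_subsetI quotientI N_iso)
  ultimately have "infinite (isospectral_classes G)"
    using finite_subset range_inj_infinite by blast
  then show ?thesis
    by (simp add: nonrecognizable_def num_isospectral_def)
qed

section \<open>Lucas polynomials over the field with nine elements\<close>

text \<open>
  If \<open>\<lambda>\<close> and \<open>\<mu>\<close> are the roots of \<open>x\<^sup>2 - t x + d\<close>, this is \<open>(\<lambda>\<^bsup>n\<^esup> - \<mu>\<^bsup>n\<^esup>) / (\<lambda> - \<mu>)\<close>,
  the coefficient of \<open>x\<close> in the remainder of \<open>x\<^bsup>n\<^esup>\<close> modulo that polynomial.
\<close>

fun lucas_U :: "'a::comm_ring_1 \<Rightarrow> 'a \<Rightarrow> nat \<Rightarrow> 'a" where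
  "lucas_U t d 0 = 0"
| "lucas_U t d (Suc 0) = 1"
| "lucas_U t d (Suc (Suc n)) = t * lucas_U t d (Suc n) - d * lucas_U t d n"

lemma lucas_U_cassini:
  "lucas_U t d n * lucas_U t d (Suc (Suc n)) = lucas_U t d (Suc n) ^ 2 - d ^ n"
proof (induction n)
  case (Suc n)
  then have "d ^ Suc n = d * (lucas_U t d (Suc n) ^ 2 - lucas_U t d n * lucas_U t d (Suc (Suc n)))"
    by simp
  then show ?case
    by simp (simp add: algebra_simps power2_eq_square)
qed simp

text \<open>
  In characteristic \<open>3\<close> the quotient \<open>(\<lambda>\<^bsup>9\<^esup> - \<mu>\<^bsup>9\<^esup>) / (\<lambda> - \<mu>)\<close> is \<open>(\<lambda> - \<mu>)\<^bsup>8\<^esup>\<close>, the fourth power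
  of the discriminant \<open>t\<^sup>2 - 4 d = t\<^sup>2 - d\<close>.
\<close>

lemma lucas_U_9_char_3:
  assumes "(3 :: 'a::comm_ring_1) = 0"
  shows "lucas_U t d 9 = (t\<^sup>2 - d :: 'a) ^ 4"
proof -
  \<comment> \<open>Over the integers the two sides differ by a multiple of \<open>3\<close>.\<close>
  have "lucas_U t d 9 - (t\<^sup>2 - d) ^ 4 = 3 * (- (t^6 * d) + 3 * t^4 * d\<^sup>2 - 2 * t\<^sup>2 * d^3)"
    by (simp add: eval_nat_numeral) (simp add: algebra_simps)
  then show ?thesis using assms by simp
qed

text \<open>
  Multiplication with \<open>x\<close> permutes the nonzero elements, so their product is unchanged by a
  factor \<open>x\<close> for each of them.
\<close>

lemma finite_field_power_card:
  fixes x :: "'f::field"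
  assumes fin: "finite (UNIV :: 'f set)" and "x \<noteq> 0"
  shows "x ^ (CARD('f) - 1) = 1"
proof -
  let ?U = "UNIV - {0 :: 'f}"
  have "\<Prod>?U = (\<Prod>y\<in>?U. x * y)"
    by (rule prod.reindex_bij_witness[of _ "\<lambda>y. x * y" "\<lambda>y. y / x"]) (use assms in auto)
  also have "\<dots> = x ^ (CARD('f) - 1) * \<Prod>?U"
    using fin by (simp add: prod.distrib)
  finally show ?thesis
    using fin by simp
qed

lemma card_9_char_3:
  assumes "CARD('f::field) = 9"
  shows "(3 :: 'f) = 0"
proof -
  have "of_nat 9 = (0 :: 'f)"
    using CHAR_dvd_CARD[where 'a = 'f] assms by (simp only: of_nat_eq_0_iff_char_dvd)
  then have "3 * 3 = (0 :: 'f)" by simp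
  then show ?thesis by (simp only: mult_eq_0_iff disj_absorb)
qed

lemma card_9_power_8:
  assumes "CARD('f::field) = 9" and "x \<noteq> (0 :: 'f)"
  shows "x ^ 8 = 1"
proof -
  have "finite (UNIV :: 'f set)"
    using assms by (auto intro: card_ge_0_finite)
  from finite_field_power_card[OF this assms(2)] show ?thesis
    by (simp add: assms)
qed

text \<open>
  If the discriminant vanishes, then so does \<open>U\<^sub>3\<close>. Otherwise Cassini's identity
  writes \<open>U\<^sub>8 U\<^sub>1\<^sub>0\<close> as a difference of two eighth powers of nonzero elements, and both
  are \<open>1\<close>.
\<close>

lemma lucas_U_vanishes:
  fixes t d :: "'f::field"
  assumes card: "CARD('f) = 9" and "d \<noteq> 0"
  shows "lucas_U t d 3 = 0 \<or> lucas_U t d 8 = 0 \<or> lucas_U t d 10 = 0"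
proof (cases "t\<^sup>2 - d = 0")
  case True
  then show ?thesis by (simp add: eval_nat_numeral)
next
  case False
  have "lucas_U t d 8 * lucas_U t d 10 = lucas_U t d 9 ^ 2 - d ^ 8"
    using lucas_U_cassini[of t d 8] by simp
  also have "\<dots> = ((t\<^sup>2 - d) ^ 4) ^ 2 - d ^ 8"
    by (simp only: lucas_U_9_char_3[OF card_9_char_3[OF card]])
  also have "\<dots> = 0"
    using card_9_power_8[OF card False] card_9_power_8[OF card \<open>d \<noteq> 0\<close>]
    by (simp flip: power_mult)
  finally show ?thesis by simp
qed

text \<open>
  Such a \<open>c\<close> is a generator of the multiplicative group: modulo \<open>3\<close> the polynomial \<open>x\<^sup>4 + 1\<close>,
  whose roots are the elements of order \<open>8\<close>, factors into \<open>x\<^sup>2 - x - 1\<close> and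
  \<open>x\<^sup>2 + x - 1\<close>. The elements of orders \<open>8\<close> and \<open>10\<close> in \<open>PGL(2,9)\<close> are built from it.
\<close>

lemma ex_quadratic_root:
  assumes card: "CARD('f::field) = 9"
  shows "\<exists>c::'f. c\<^sup>2 = c + 1"
proof -
  have fin: "finite (UNIV :: 'f set)"
    using assms by (auto intro: card_ge_0_finite)
  let ?p = "monom 1 4 - 1 :: 'f poly"
  have p: "degree ?p \<le> 4" "?p \<noteq> 0"
  proof -
    show "degree ?p \<le> 4"
      by (rule degree_diff_le) (auto simp: degree_monom_le)
    have "coeff ?p 4 = 1" by simp
    then show "?p \<noteq> 0" by force
  qed
  \<comment> \<open>The polynomial \<open>x\<^sup>4 - 1\<close> has at most four of the eight nonzero elements as roots.\<close>
  have "\<exists>g::'f. g \<noteq> 0 \<and> g ^ 4 \<noteq> 1"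
  proof (rule ccontr)
    assume "\<nexists>g::'f. g \<noteq> 0 \<and> g ^ 4 \<noteq> 1"
    then have "UNIV - {0} \<subseteq> {x. poly ?p x = 0}"
      by (auto simp: poly_monom)
    then have "card (UNIV - {0::'f}) \<le> card {x. poly ?p x = 0}"
      by (intro card_mono finite_subset[OF _ fin]) auto
    then show False
      using card_poly_roots_bound[OF p(2)] p(1) fin card by simp
  qed
  then obtain g :: 'f where g: "g \<noteq> 0" "g ^ 4 \<noteq> 1" by blast
  have "(g ^ 4 - 1) * (g ^ 4 + 1) = g ^ 8 - 1"
    by (simp add: eval_nat_numeral algebra_simps)
  also have "\<dots> = 0"
    using card_9_power_8[OF card g(1)] by simp
  finally have "g ^ 4 + 1 = 0"
    using g by simp
  moreover have "(g\<^sup>2 - g - 1) * ((- g)\<^sup>2 - (- g) - 1) = g ^ 4 + 1 - 3 * g\<^sup>2"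
    by (simp add: eval_nat_numeral algebra_simps)
  ultimately have "(g\<^sup>2 - g - 1) * ((- g)\<^sup>2 - (- g) - 1) = 0"
    using card_9_char_3[OF card] by simp
  then have "g\<^sup>2 - g - 1 = 0 \<or> (- g)\<^sup>2 - (- g) - 1 = 0"
    by (simp only: mult_eq_0_iff)
  then show ?thesis
    by (metis diff_diff_add eq_iff_diff_eq_0)
qed

section \<open>The spectrum of the projective group\<close>

lemma PGL_pow_eq_one_iff:
  fixes A :: "'f::field ^ 'n ^ 'n" and n :: nat
  defines "Z \<equiv> {mat c |c. c \<noteq> 0} :: ('f ^ 'n ^ 'n) set"
  assumes A: "A \<in> carrier GL"
  shows "(Z #>\<^bsub>GL\<^esub> A) [^]\<^bsub>PGL\<^esub> n = \<one>\<^bsub>PGL\<^esub> \<longleftrightarrow> (\<exists>c. A [^]\<^bsub>GL\<^esub> n = mat c)"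
proof -
  interpret normal Z GL
    unfolding Z_def by (rule normal_scalars)
  have "(Z #>\<^bsub>GL\<^esub> A) [^]\<^bsub>PGL\<^esub> n = Z #>\<^bsub>GL\<^esub> (A [^]\<^bsub>GL\<^esub> n)"
    using hom_nat_pow[OF r_coset_hom_Mod A is_group] factorgroup_is_group
    by (simp add: PGL_def Z_def)
  also have "\<dots> = \<one>\<^bsub>PGL\<^esub> \<longleftrightarrow> A [^]\<^bsub>GL\<^esub> n \<in> Z"
  proof -
    have "\<one>\<^bsub>PGL\<^esub> = Z"
      by (simp add: PGL_def FactGroup_def Z_def)
    then show ?thesis
      using coset_join1 coset_join2 subgroup_axioms nat_pow_closed[OF A] by metis
  qed
  also have "\<dots> \<longleftrightarrow> (\<exists>c. A [^]\<^bsub>GL\<^esub> n = mat c)"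
  proof -
    have "mat 0 \<noteq> A [^]\<^bsub>GL\<^esub> n"
    proof
      assume "mat 0 = A [^]\<^bsub>GL\<^esub> n"
      then have "invertible (mat 0 :: 'f ^ 'n ^ 'n)"
        using nat_pow_closed[OF A, of n] by (simp add: GL_def)
      then obtain B :: "'f ^ 'n ^ 'n" where "mat 0 ** B = mat 1"
        by (auto simp: invertible_def)
      then have "(mat 0 ** B) $ undefined $ undefined = (1 :: 'f)"
        by (simp add: mat_def)
      then show False by (simp add: mat_mult_nth)
    qed
    then show ?thesis by (auto simp: Z_def)
  qed
  finally show ?thesis .
qed

text \<open>
  By Cayley-Hamilton \<open>A\<^sup>2 = t A - d\<close>, so the powers of \<open>A\<close> satisfy the recursion of the Lucas
  polynomials. The formula is stated entrywise and for \<open>n + 1\<close> because \<open>U\<^sub>n\<close> with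
  \<open>n = -1\<close> would occur for the power \<open>0\<close>.
\<close>

lemma GL_pow_lucas_U:
  fixes A :: "'f::field ^ 2 ^ 2" and n :: nat
  defines "t \<equiv> A $ 1 $ 1 + A $ 2 $ 2" and "d \<equiv> det A"
  assumes "A \<in> carrier GL"
  shows "(A [^]\<^bsub>GL\<^esub> Suc n) $ i $ j = lucas_U t d (Suc n) * A $ i $ j - d * lucas_U t d n * mat 1 $ i $ j"
proof (induction n arbitrary: i j)
  interpret GL: group "GL :: ('f ^ 2 ^ 2) monoid" by (rule group_GL)
  case 0
  show ?case using assms by (simp add: GL.nat_pow_Suc)
next
  interpret GL: group "GL :: ('f ^ 2 ^ 2) monoid" by (rule group_GL)
  case (Suc n)
  define u v where "u = lucas_U t d (Suc n)" and "v = lucas_U t d n"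
  have "A [^]\<^bsub>GL\<^esub> Suc (Suc n) = (A [^]\<^bsub>GL\<^esub> Suc n) ** A"
    by (simp add: GL.nat_pow_Suc) (simp add: GL_def)
  then have "(A [^]\<^bsub>GL\<^esub> Suc (Suc n)) $ i $ j = (\<Sum>k\<in>UNIV. (A [^]\<^bsub>GL\<^esub> Suc n) $ i $ k * A $ k $ j)"
    by (simp add: matrix_matrix_mult_def)
  also have "\<dots> = (\<Sum>k\<in>UNIV. (u * A $ i $ k - d * v * mat 1 $ i $ k) * A $ k $ j)"
    by (simp only: Suc u_def v_def)
  also have "\<dots> = (t * u - d * v) * A $ i $ j - d * u * mat 1 $ i $ j"
    using exhaust_2[of i] exhaust_2[of j]
    by (auto simp: sum_2 mat_def t_def d_def det_2 algebra_simps)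
  finally show ?case by (simp add: u_def v_def)
qed

lemma GL_pow_scalar_if:
  fixes A :: "'f::field ^ 2 ^ 2" and n :: nat
  assumes A: "A \<in> carrier GL" and n: "n > 0" "lucas_U (A $ 1 $ 1 + A $ 2 $ 2) (det A) n = 0"
  shows "\<exists>c. A [^]\<^bsub>GL\<^esub> n = mat c"
proof -
  obtain m where "n = Suc m" using n by (cases n) auto
  then have "A [^]\<^bsub>GL\<^esub> n = mat (- (det A * lucas_U (A $ 1 $ 1 + A $ 2 $ 2) (det A) m))"
    using n by (simp add: vec_eq_iff GL_pow_lucas_U[OF A] mat_def del: Group.nat_pow_Suc)
  then show ?thesis by blast
qed

text \<open>
  A companion matrix realises every pair of trace and determinant, and its lower left entry
  \<open>1\<close> turns the vanishing of \<open>U\<^sub>n\<close> into a necessary condition as well.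
\<close>

definition companion :: "'f::field \<Rightarrow> 'f \<Rightarrow> 'f ^ 2 ^ 2" where
  "companion t d = (\<chi> i j. if i = 1 then (if j = 1 then 0 else - d) else (if j = 1 then 1 else t))"

lemma companion_nth [simp]:
  "companion t d $ 1 $ 1 = 0" "companion t d $ 1 $ 2 = - d"
  "companion t d $ 2 $ 1 = 1" "companion t d $ 2 $ 2 = t"
  by (simp_all add: companion_def)

lemma det_companion [simp]: "det (companion t d) = d"
  by (simp add: det_2)

lemma companion_in_GL:
  assumes "d \<noteq> (0::'f::field)"
  shows "companion t d \<in> carrier GL"
  using assms by (simp add: GL_def invertible_det_nz)

lemma companion_pow_scalar_iff:
  fixes t d :: "'f::field" and n :: nat
  assumes d: "d \<noteq> 0"
  shows "(\<exists>c. companion t d [^]\<^bsub>GL\<^esub> n = mat c) \<longleftrightarrow> lucas_U t d n = 0"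
proof (cases n)
  case 0
  then show ?thesis by (auto simp: GL_def)
next
  case (Suc m)
  have "lucas_U t d n = 0" if "companion t d [^]\<^bsub>GL\<^esub> n = mat c" for c
  proof -
    have "(companion t d [^]\<^bsub>GL\<^esub> n) $ 2 $ 1 = lucas_U t d n"
      unfolding Suc by (subst GL_pow_lucas_U[OF companion_in_GL[OF d]]) (simp add: mat_def)
    then show ?thesis unfolding that by (simp add: mat_def)
  qed
  then show ?thesis
    using GL_pow_scalar_if[OF companion_in_GL[OF d], of n t] by (auto simp: Suc)
qed

lemma spectrum_PGL_2_9:
  assumes card: "CARD('f::field) = 9"
  shows "spectrum (PGL :: ('f ^ 2 ^ 2) set monoid) = {1, 2, 3, 4, 5, 8, 10}"
proof -
  define Z :: "('f ^ 2 ^ 2) set" where "Z = {mat c |c. c \<noteq> 0}"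
  interpret PGL: group "PGL :: ('f ^ 2 ^ 2) set monoid" by (rule group_PGL)
  have carrier: "carrier PGL = (\<lambda>A. Z #>\<^bsub>GL\<^esub> A) ` carrier GL"
    by (auto simp: PGL_def FactGroup_def RCOSETS_def Z_def)
  define P where "P t d = Z #>\<^bsub>GL\<^esub> companion t d" for t d
  have P_in: "P t d \<in> carrier PGL" if "d \<noteq> 0" for t d
    using companion_in_GL[OF that] by (auto simp: carrier P_def)
  have P_pow: "P t d [^]\<^bsub>PGL\<^esub> n = \<one>\<^bsub>PGL\<^esub> \<longleftrightarrow> lucas_U t d n = 0" if "d \<noteq> 0" for t d and n :: nat
    using PGL_pow_eq_one_iff[OF companion_in_GL[OF that]] companion_pow_scalar_iff[OF that]
    by (simp add: P_def Z_def)
  have three: "(3 :: 'f) = 0" by (rule card_9_char_3[OF card])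
  obtain c :: 'f where c: "c\<^sup>2 = c + 1"
    using ex_quadratic_root[OF card] by blast
  have c_nz: "c \<noteq> 0" "c \<noteq> 1"
  proof -
    show "c \<noteq> 0" using c by auto
    show "c \<noteq> 1"
    proof
      assume "c = 1"
      then have "1 + 0 = 1 + (1 :: 'f)" using c by simp
      then show False by (simp only: add_left_cancel zero_neq_one)
    qed
  qed
  (* Trace and determinant (-1, 1) have discriminant 0 and give order 3. For trace 1 the factor
     U_10 / U_5 is 1 - 5 d + 5 d^2, which modulo 3 is -(d^2 - d - 1) and vanishes at d = c;
     the factor U_8 / U_4 is 1 - 4 d + 2 d^2, which modulo 3 is -(d^2 + d - 1) and vanishes
     at d = -c. The identities below are these factorisations over the integers, with the
     multiples of 3 kept apart. *)
  show ?thesis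
  proof (rule PGL.spectrum_3_8_10I)
    fix X :: "('f ^ 2 ^ 2) set" assume "X \<in> carrier PGL"
    then obtain A where A: "A \<in> carrier GL" "X = Z #>\<^bsub>GL\<^esub> A"
      by (auto simp: carrier)
    have "det A \<noteq> 0" using A by (simp add: GL_def invertible_det_nz)
    from lucas_U_vanishes[OF card this, of "A $ 1 $ 1 + A $ 2 $ 2"]
    show "X [^]\<^bsub>PGL\<^esub> (3::nat) = \<one>\<^bsub>PGL\<^esub> \<or> X [^]\<^bsub>PGL\<^esub> (8::nat) = \<one>\<^bsub>PGL\<^esub> \<or> X [^]\<^bsub>PGL\<^esub> (10::nat) = \<one>\<^bsub>PGL\<^esub>"
      unfolding A Z_def PGL_pow_eq_one_iff[OF A(1)]
      using GL_pow_scalar_if[OF A(1)] by (metis zero_less_numeral)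
  next
    show "P (- 1) 1 [^]\<^bsub>PGL\<^esub> (3::nat) = \<one>\<^bsub>PGL\<^esub>"
    proof -
      have "lucas_U (- 1) 1 3 = (0 :: 'f)" by (simp add: eval_nat_numeral)
      then show ?thesis by (simp add: P_pow)
    qed
    show "P (- 1) 1 \<noteq> \<one>\<^bsub>PGL\<^esub>"
      using P_pow[of 1 "- 1" 1] P_in[of 1 "- 1"] by simp
  next
    have "lucas_U 1 (- c) 8 = (1 + 2 * c) * (3 * (c\<^sup>2 + c) - (c\<^sup>2 - c - 1))"
      by (simp add: eval_nat_numeral algebra_simps)
    then show "P 1 (- c) [^]\<^bsub>PGL\<^esub> (8::nat) = \<one>\<^bsub>PGL\<^esub>"
      using c_nz by (simp add: P_pow three c)
    have "lucas_U 1 (- c) 4 = 1 - c + 3 * c"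
      by (simp add: eval_nat_numeral algebra_simps)
    then show "P 1 (- c) [^]\<^bsub>PGL\<^esub> (4::nat) \<noteq> \<one>\<^bsub>PGL\<^esub>"
      using c_nz by (simp add: P_pow three)
  next
    have "lucas_U 1 c 10 = (c\<^sup>2 + 1 - 3 * c) * (3 * (2 * c\<^sup>2 - 2 * c) - (c\<^sup>2 - c - 1))"
      by (simp add: eval_nat_numeral algebra_simps)
    then show "P 1 c [^]\<^bsub>PGL\<^esub> (10::nat) = \<one>\<^bsub>PGL\<^esub>"
      using c_nz by (simp add: P_pow three c)
    have "lucas_U 1 c 5 = (c\<^sup>2 - c - 1) + (c - 1) + 3 * (1 - c)"
      by (simp add: eval_nat_numeral algebra_simps)
    then show "P 1 c [^]\<^bsub>PGL\<^esub> (5::nat) \<noteq> \<one>\<^bsub>PGL\<^esub>"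
      using c_nz by (simp add: P_pow three c)
    have "lucas_U 1 c 2 = 1"
      by (simp add: eval_nat_numeral)
    then show "P 1 c [^]\<^bsub>PGL\<^esub> (2::nat) \<noteq> \<one>\<^bsub>PGL\<^esub>"
      using c_nz by (simp add: P_pow)
  qed (use c_nz in \<open>auto simp: P_in\<close>)
qed


section \<open>Affine groups with fixed-point-free linear part\<close>

locale fixed_point_free_linear_maps =
  fixes T :: "('w::ab_group_add \<Rightarrow> 'w) set"
  assumes id_mem: "id \<in> T"
    and comp_mem: "g \<in> T \<Longrightarrow> h \<in> T \<Longrightarrow> g \<circ> h \<in> T"
    and left_inverse: "g \<in> T \<Longrightarrow> \<exists>h\<in>T. h \<circ> g = id"
    and additive: "g \<in> T \<Longrightarrow> g (x + y) = g x + g y"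
    and fixed_point_free: "g \<in> T \<Longrightarrow> g \<noteq> id \<Longrightarrow> g x = x \<Longrightarrow> x = 0"

text \<open>
  The semidirect product of the \<open>k\<close>-th power of \<open>'w\<close> and \<open>T\<close>, acting on each component; the pair
  \<open>(v, g)\<close> stands for the affine map \<open>w \<mapsto> v + g w\<close>. The power is encoded by sequences that
  vanish from \<open>k\<close> on, so that the groups for all \<open>k\<close> have the same type.
\<close>

definition affine_power :: "nat \<Rightarrow> ('w::ab_group_add \<Rightarrow> 'w) set \<Rightarrow> ((nat \<Rightarrow> 'w) \<times> ('w \<Rightarrow> 'w)) monoid" where
  "affine_power k T =
     \<lparr>carrier = {v. \<forall>n\<ge>k. v n = 0} \<times> T,
      monoid.mult = (\<lambda>(v, g) (w, h). (\<lambda>n. v n + g (w n), g \<circ> h)),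
      one = (\<lambda>_. 0, id)\<rparr>"

lemma affine_power_simps:
  "carrier (affine_power k T) = {v. \<forall>n\<ge>k. v n = 0} \<times> T"
  "(v, g) \<otimes>\<^bsub>affine_power k T\<^esub> (w, h) = (\<lambda>n. v n + g (w n), g \<circ> h)"
  "\<one>\<^bsub>affine_power k T\<^esub> = (\<lambda>_. 0, id)"
  by (simp_all add: affine_power_def)

context fixed_point_free_linear_maps
begin

lemma map_zero: "g \<in> T \<Longrightarrow> g 0 = 0"
  using additive[of g 0 0] by simp

lemma map_sum: "g \<in> T \<Longrightarrow> g (\<Sum>i<n. f i) = (\<Sum>i<n. g (f i))" for n :: nat
  by (induction n) (simp_all add: additive map_zero)

lemma group_affine_power: "group (affine_power k T)"
proof (rule groupI)
  fix x assume "x \<in> carrier (affine_power k T)"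
  then obtain v g where x: "x = (v, g)" "\<forall>n\<ge>k. v n = 0" "g \<in> T"
    by (auto simp: affine_power_simps)
  obtain h where h: "h \<in> T" "h \<circ> g = id"
    using left_inverse x by blast
  then have "(\<lambda>n. - h (v n), h) \<in> carrier (affine_power k T)"
    and "(\<lambda>n. - h (v n), h) \<otimes>\<^bsub>affine_power k T\<^esub> x = \<one>\<^bsub>affine_power k T\<^esub>"
    using x by (auto simp: affine_power_simps map_zero)
  then show "\<exists>y\<in>carrier (affine_power k T). y \<otimes>\<^bsub>affine_power k T\<^esub> x = \<one>\<^bsub>affine_power k T\<^esub>"
    by blast
qed (auto simp: affine_power_simps id_mem comp_mem additive map_zero add.assoc comp_assoc)

lemma affine_power_pow:
  "(v, g) [^]\<^bsub>affine_power k T\<^esub> n = (\<lambda>m. \<Sum>i<n. (g ^^ i) (v m), g ^^ n)" for n :: nat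
  by (induction n) (simp_all add: affine_power_simps nat_pow_def funpow_swap1 fun_eq_iff)

text \<open>
  The translation part of the \<open>n\<close>-th power is \<open>v + g v + \<dots> + g\<^bsup>n - 1\<^esup> v\<close>. Applying \<open>g\<close> to it
  shifts the summands cyclically when \<open>g\<^bsup>n\<^esup> = 1\<close>, so it is a fixed vector of \<open>g\<close> and
  therefore zero.
\<close>

lemma affine_power_pow_eq_one_iff:
  fixes n :: nat
  assumes "g \<in> T" "g \<noteq> id"
  shows "(v, g) [^]\<^bsub>affine_power k T\<^esub> n = \<one>\<^bsub>affine_power k T\<^esub> \<longleftrightarrow> g ^^ n = id"
proof -
  have "(\<Sum>i<n. (g ^^ i) x) = 0" if "g ^^ n = id" for x
  proof (rule fixed_point_free[OF assms])
    have "g (\<Sum>i<n. (g ^^ i) x) = (\<Sum>i<n. (g ^^ Suc i) x)"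
      by (simp add: map_sum[OF assms(1)])
    also have "\<dots> = (\<Sum>i<n. (g ^^ i) x)"
      using sum.lessThan_Suc_shift[of "\<lambda>i. (g ^^ i) x" n] that by (simp add: add.commute)
    finally show "g (\<Sum>i<n. (g ^^ i) x) = (\<Sum>i<n. (g ^^ i) x)" .
  qed
  then show ?thesis
    by (auto simp: affine_power_pow affine_power_simps)
qed

end

lemma finite_finitely_supported:
  "finite {v :: nat \<Rightarrow> 'w::{finite,zero}. \<forall>n\<ge>k. v n = 0}"
  using finite_set_of_finite_funs[of "{..<k}" "UNIV :: 'w set" 0] by (simp add: not_less)

text \<open>
  The exponent starts at \<open>1\<close> because for exponent \<open>0\<close> the group is \<open>T\<close> itself, which need not
  contain elements of order \<open>3\<close>.
\<close>

lemma inj_card_affine_power: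
  fixes T :: "('w::{finite,ab_group_add} \<Rightarrow> 'w) set"
  assumes "T \<noteq> {}" "a \<noteq> (0::'w)"
  shows "inj (\<lambda>k. card (carrier (affine_power (Suc k) T)))"
proof -
  let ?V = "\<lambda>k. {v :: nat \<Rightarrow> 'w. \<forall>n\<ge>k. v n = 0}"
  have "card (?V k) < card (?V (Suc k))" for k
  proof (rule psubset_card_mono[OF finite_finitely_supported])
    have "(\<lambda>_. 0)(k := a) \<in> ?V (Suc k) - ?V k"
      using assms by auto
    moreover have "?V k \<subseteq> ?V (Suc k)" by auto
    ultimately show "?V k \<subset> ?V (Suc k)" by blast
  qed
  moreover have "card T > 0"
    using assms by (simp add: card_gt_0_iff)
  ultimately have "strict_mono (\<lambda>k. card (carrier (affine_power (Suc k) T)))"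
    by (simp add: strict_mono_Suc_iff affine_power_simps card_cartesian_product)
  then show ?thesis by (rule strict_mono_imp_inj_on)
qed

section \<open>A fixed-point-free group of order 40 on the field with 81 elements\<close>

text \<open>
  The quadruple \<open>(x, y, z, w)\<close> stands for \<open>x + y \<zeta> + z \<zeta>\<^sup>2 + w \<zeta>\<^bsup>3\<^esup>\<close> with
  \<open>1 + \<zeta> + \<zeta>\<^sup>2 + \<zeta>\<^bsup>3\<^esup> + \<zeta>\<^bsup>4\<^esup> = 0\<close>. The coefficients lie in any commutative ring, so that
  the relations between the two maps can be read off before reducing modulo \<open>3\<close>.
\<close>


fun zeta_mult :: "'a::comm_ring_1 \<times> 'a \<times> 'a \<times> 'a \<Rightarrow> 'a \<times> 'a \<times> 'a \<times> 'a" where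
  "zeta_mult (x, y, z, w) = (- w, x - w, y - w, z - w)"

text \<open>
  The image of \<open>u\<close> is \<open>1 - \<zeta>\<close> times the element obtained from \<open>u\<close> by the substitution
  \<open>\<zeta> \<mapsto> \<zeta>\<^bsup>3\<^esup>\<close>.
\<close>

fun twist :: "'a::comm_ring_1 \<times> 'a \<times> 'a \<times> 'a \<Rightarrow> 'a \<times> 'a \<times> 'a \<times> 'a" where
  "twist (x, y, z, w) = (x + y - 2 * w, - x + y + z - w, y - z - w, 2 * y - w)"

lemma zeta_mult_add: "zeta_mult (u + v) = zeta_mult u + zeta_mult v"
  by (cases u; cases v) (simp add: algebra_simps)

lemma twist_add: "twist (u + v) = twist u + twist v"
  by (cases u; cases v) (simp add: algebra_simps)

lemma funpow_additive:
  fixes f :: "'w::plus \<Rightarrow> 'w"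
  assumes "\<And>u v. f (u + v) = f u + f v"
  shows "(f ^^ n) (u + v) = (f ^^ n) u + (f ^^ n) v"
  by (induction n) (simp_all add: assms)

lemma zeta_mult_pow_5: "zeta_mult ^^ 5 = id"
  by (rule ext) (auto simp: eval_nat_numeral)

lemma twist_zeta_mult: "twist \<circ> zeta_mult = zeta_mult ^^ 3 \<circ> twist"
  by (rule ext) (auto simp: eval_nat_numeral algebra_simps)

text \<open>
  The substitution \<open>\<zeta> \<mapsto> \<zeta>\<^bsup>3\<^esup>\<close> has order \<open>4\<close>, hence the fourth power of \<open>twist\<close> is multiplication
  with \<open>(1 - \<zeta>) (1 - \<zeta>\<^bsup>3\<^esup>) (1 - \<zeta>\<^bsup>4\<^esup>) (1 - \<zeta>\<^sup>2)\<close>, the value at \<open>1\<close> of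
  \<open>1 + X + X\<^sup>2 + X\<^bsup>3\<^esup> + X\<^bsup>4\<^esup>\<close>.
\<close>

lemma twist_pow_4: "(twist ^^ 4) (x, y, z, w) = (5 * x, 5 * y, 5 * z, 5 * w)"
  by (simp add: eval_nat_numeral algebra_simps)

text \<open>
  The relation lets every word in \<open>a\<close> and \<open>b\<close> be sorted into the form \<open>a\<^bsup>i\<^esup> b\<^bsup>j\<^esup>\<close>; powers of
  such a word produce geometric sums in the exponent of \<open>a\<close>.
\<close>

locale metacyclic_maps =
  fixes a b :: "'w \<Rightarrow> 'w" and r :: nat
  assumes b_a: "b \<circ> a = a ^^ r \<circ> b"
begin

lemma b_pow_a_pow: "b ^^ j \<circ> a ^^ i = a ^^ (r ^ j * i) \<circ> b ^^ j"
proof -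
  have one: "b \<circ> a ^^ i = a ^^ (r * i) \<circ> b" for i
  proof (induction i)
    case (Suc i)
    have "b \<circ> a ^^ Suc i = (b \<circ> a) \<circ> a ^^ i"
      by (simp add: comp_assoc)
    also have "\<dots> = a ^^ r \<circ> (b \<circ> a ^^ i)"
      by (simp only: b_a comp_assoc)
    also have "\<dots> = a ^^ (r * Suc i) \<circ> b"
      by (simp only: Suc mult_Suc_right funpow_add comp_assoc)
    finally show ?case .
  qed simp
  show ?thesis
  proof (induction j)
    case (Suc j)
    have "b ^^ Suc j \<circ> a ^^ i = b \<circ> (b ^^ j \<circ> a ^^ i)"
      by (simp add: comp_assoc)
    also have "\<dots> = (b \<circ> a ^^ (r ^ j * i)) \<circ> b ^^ j"
      by (simp only: Suc comp_assoc)
    also have "\<dots> = a ^^ (r ^ Suc j * i) \<circ> b ^^ Suc j"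
      by (simp only: one comp_assoc funpow.simps power_Suc mult.assoc)
    finally show ?case .
  qed simp
qed

lemma comp_normal_form:
  "(a ^^ i \<circ> b ^^ j) \<circ> (a ^^ k \<circ> b ^^ l) = a ^^ (i + r ^ j * k) \<circ> b ^^ (j + l)"
proof -
  have "(a ^^ i \<circ> b ^^ j) \<circ> (a ^^ k \<circ> b ^^ l) = a ^^ i \<circ> (b ^^ j \<circ> a ^^ k) \<circ> b ^^ l"
    by (simp only: comp_assoc)
  also have "\<dots> = a ^^ (i + r ^ j * k) \<circ> b ^^ (j + l)"
    by (simp only: b_pow_a_pow funpow_add comp_assoc)
  finally show ?thesis .
qed

lemma funpow_normal_form:
  "(a ^^ i \<circ> b ^^ j) ^^ n = a ^^ (i * (\<Sum>m<n. (r ^ j) ^ m)) \<circ> b ^^ (j * n)"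
proof (induction n)
  case (Suc n)
  have "(a ^^ i \<circ> b ^^ j) ^^ Suc n
      = a ^^ (i + r ^ j * (i * (\<Sum>m<n. (r ^ j) ^ m))) \<circ> b ^^ (j + j * n)"
    by (simp only: funpow.simps Suc comp_normal_form)
  also have "i + r ^ j * (i * (\<Sum>m<n. (r ^ j) ^ m)) = i * (\<Sum>m<Suc n. (r ^ j) ^ m)"
    by (subst sum.lessThan_Suc_shift) (simp add: algebra_simps sum_distrib_left)
  finally show ?case by simp
qed simp

end

type_synonym f81 = "3 \<times> 3 \<times> 3 \<times> 3"

interpretation zeta_twist: metacyclic_maps "zeta_mult :: f81 \<Rightarrow> f81" twist 3
  by unfold_locales (rule twist_zeta_mult)

lemma three_eq_0: "(3::3) = 0"
  by simp

lemma zeta_mult_pow_dvd: "5 dvd n \<Longrightarrow> zeta_mult ^^ n = id"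
  by (elim dvdE) (simp flip: funpow_mult add: zeta_mult_pow_5)

lemma uminus_funpow_even: "even n \<Longrightarrow> (uminus :: 'a::ab_group_add \<Rightarrow> 'a) ^^ n = id"
proof (elim dvdE)
  fix k assume n: "n = 2 * k"
  have "(uminus :: 'a \<Rightarrow> 'a) ^^ 2 = id" by (simp add: fun_eq_iff eval_nat_numeral)
  then show "(uminus :: 'a \<Rightarrow> 'a) ^^ n = id" by (simp add: n flip: funpow_mult)
qed

lemma uminus_funpow_odd: "odd n \<Longrightarrow> (uminus :: 'a::ab_group_add \<Rightarrow> 'a) ^^ n = uminus"
  by (elim oddE) (simp add: uminus_funpow_even)

lemma five_times: "5 * x = - x" for x :: 3
proof -
  have "5 * x + x = (5 + 1) * x" by (simp only: distrib_right mult_1_left)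
  also have "(5 + 1 :: 3) = 0" by simp
  finally show ?thesis by (simp add: eq_neg_iff_add_eq_0)
qed

lemma twist_pow_4_f81: "(twist :: f81 \<Rightarrow> f81) ^^ 4 = uminus"
  by (intro ext) (auto simp: twist_pow_4 five_times)

lemma eq_uminus_f81: "v = 0" if "- v = v" for v :: f81
proof -
  have "a = 0" if "- a = a" for a :: 3
  proof -
    have "a + a = 0" using that by (metis add.right_inverse)
    moreover have "a + a + a = 3 * a" by simp
    ultimately show ?thesis by (simp add: three_eq_0)
  qed
  with that show ?thesis by (cases v) (simp add: zero_prod_def)
qed

text \<open>
  Nothing restricts the exponents, which makes closure under composition immediate from the
  normal form.
\<close>

definition frobenius_complement :: "(f81 \<Rightarrow> f81) set" where
  "frobenius_complement = {zeta_mult ^^ i \<circ> twist ^^ j |i j. True}"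

text \<open>
  The number of factors \<open>n\<close> is chosen such that the exponent of \<open>\<zeta>\<close> in the \<open>n\<close>-th power of
  \<open>a\<^bsup>i\<^esup> b\<^bsup>j\<^esup>\<close>, a multiple of \<open>1 + q + \<dots> + q\<^bsup>n - 1\<^esup>\<close> for \<open>q = 3\<^bsup>j\<^esup>\<close>, is divisible by \<open>5\<close>:
  this sum has four terms if \<open>q\<close> is a primitive root modulo \<open>5\<close>, two if \<open>q = -1\<close>, and five
  if \<open>q = 1\<close>. What remains is an odd power of \<open>b\<^bsup>4\<^esup> = -1\<close>, except when \<open>b\<^bsup>j\<^esup> = 1\<close> from the
  start.
\<close>

lemma frobenius_complement_cases:
  assumes "g \<in> frobenius_complement"
  obtains (rotation) i where "g = zeta_mult ^^ i"
  | (minus) n where "n \<in> {2, 4, 5}" "g ^^ n = uminus"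
proof -
  obtain i j where g: "g = zeta_mult ^^ i \<circ> twist ^^ j"
    using assms by (auto simp: frobenius_complement_def)
  have tw: "(twist :: f81 \<Rightarrow> f81) ^^ (4 * m) = uminus ^^ m" for m
    by (simp add: twist_pow_4_f81 flip: funpow_mult)
  have dvd: "5 dvd m" if "[m = 0] (mod 5)" for m :: nat
    using that by (simp add: cong_0_iff)
  consider (odd) "odd j" | (two) m where "j = 2 * m" "odd m" 
    | (four) m where "j = 4 * m" "odd m" | (eight) m where "j = 8 * m"
  proof -
    have "odd j \<or> (\<exists>m. j = 2 * m \<and> odd m) \<or> (\<exists>m. j = 4 * m \<and> odd m) \<or> (\<exists>m. j = 8 * m)"
      by presburger
    then show thesis using that by blast
  qed
  then show thesis
  proof cases
    case odd
    then obtain m where m: "j = 2 * m + 1" by (rule oddE)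
    have "(3::nat) ^ j * 3 ^ j + 1 = 9 ^ j + 1"
      by (simp flip: power_mult_distrib)
    also have "[\<dots> = 4 ^ j + 1] (mod 5)"
      by (intro cong_add cong_pow) (simp_all add: cong_def)
    also have "4 ^ j + 1 = (16::nat) ^ m * 4 + 1"
      by (simp add: m power_mult)
    also have "[\<dots> = 1 ^ m * 4 + 1] (mod 5)"
      by (intro cong_add cong_mult cong_pow) (simp_all add: cong_def)
    finally have "(5::nat) dvd 3 ^ j * 3 ^ j + 1"
      by (intro dvd) (simp add: cong_def)
    moreover have "(\<Sum>m<4. (3 ^ j) ^ m) = (3 ^ j * 3 ^ j + 1) * (1 + 3 ^ j :: nat)"
      by (simp add: eval_nat_numeral algebra_simps)
    ultimately have "5 dvd i * (\<Sum>m<4. (3 ^ j) ^ m)"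
      by (metis dvd_mult dvd_mult2)
    then have "g ^^ 4 = uminus"
      unfolding g zeta_twist.funpow_normal_form
      using tw[of j] odd by (simp add: zeta_mult_pow_dvd uminus_funpow_odd mult.commute)
    then show thesis using minus[of 4] by simp
  next
    case (two m)
    then obtain l where l: "m = 2 * l + 1" by (auto elim: oddE)
    have "1 + (3::nat) ^ j = 81 ^ l * 9 + 1"
      by (simp add: two l power_add power_mult)
    also have "[\<dots> = 1 ^ l * 9 + 1] (mod 5)"
      by (intro cong_add cong_mult cong_pow) (simp_all add: cong_def)
    finally have "5 dvd 1 + (3::nat) ^ j"
      by (intro dvd) (simp add: cong_def)
    moreover have "(\<Sum>m<2. (3 ^ j) ^ m) = (1 + 3 ^ j :: nat)"
      by (simp add: eval_nat_numeral)
    ultimately have "5 dvd i * (\<Sum>m<2. (3 ^ j) ^ m)"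
      by (metis dvd_mult)
    then have "g ^^ 2 = uminus"
      unfolding g zeta_twist.funpow_normal_form
      using tw[of m] two by (simp add: zeta_mult_pow_dvd uminus_funpow_odd mult.commute)
    then show thesis using minus[of 2] by simp
  next
    case (four m)
    have "[\<Sum>k<5. (3 ^ j) ^ k = \<Sum>k<5. 1 ^ k] (mod (5::nat))"
    proof (intro cong_sum cong_pow)
      have "(3::nat) ^ j = 81 ^ m" by (simp add: four power_mult)
      also have "[\<dots> = 1 ^ m] (mod 5)"
        by (intro cong_pow) (simp add: cong_def)
      finally show "[3 ^ j = 1] (mod (5::nat))" by simp
    qed
    then have "5 dvd i * (\<Sum>k<5. (3 ^ j) ^ k)"
      by (intro dvd_mult dvd) (simp add: cong_def)
    then have "g ^^ 5 = uminus"
      unfolding g zeta_twist.funpow_normal_form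
      using tw[of "5 * m"] four by (simp add: zeta_mult_pow_dvd uminus_funpow_odd mult_ac)
    then show thesis using minus[of 5] by simp
  next
    case (eight m)
    then have "g = zeta_mult ^^ i"
      using tw[of "2 * m"] by (simp add: g uminus_funpow_even)
    then show thesis by (rule rotation)
  qed
qed

lemma frobenius_complement_exponent:
  assumes "g \<in> frobenius_complement"
  shows "g ^^ 8 = id \<or> g ^^ 10 = id"
  using assms
proof (cases rule: frobenius_complement_cases)
  case (rotation i)
  then have "g ^^ 10 = id" by (simp add: funpow_mult zeta_mult_pow_dvd)
  then show ?thesis ..
next
  case (minus n)
  have "g ^^ (n * m) = id" if "even m" for m
    using minus that by (simp add: uminus_funpow_even flip: funpow_mult)
  from this[of 2] this[of 4] show ?thesis
    using minus(1) by auto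
qed

text \<open>
  A vector fixed by \<open>g\<close> is fixed by its powers. One of them is \<open>-1\<close> or, for a nontrivial power
  of \<open>\<zeta>\<close>, multiplication with \<open>\<zeta>\<close> itself.
\<close>

lemma frobenius_complement_fixed_point_free:
  assumes "g \<in> frobenius_complement" "g \<noteq> id" "g v = v"
  shows "v = 0"
proof -
  have fixed: "(g ^^ n) v = v" for n
    using assms by (induction n) simp_all
  show ?thesis
    using assms(1)
  proof (cases rule: frobenius_complement_cases)
    case (rotation i)
    have "\<not> 5 dvd i"
      using assms(2) zeta_mult_pow_dvd by (auto simp: rotation)
    moreover have "prime (5::nat)" by simp
    ultimately have "coprime i 5"
      by (metis prime_imp_coprime coprime_commute)
    then obtain m where m: "[i * m = Suc 0] (mod 5)"
      using cong_solve_coprime_nat by blast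
    define q where "q = i * m div 5"
    have "i * m = 5 * q + 1"
      using m div_mult_mod_eq[of "i * m" 5] by (simp add: q_def cong_def)
    then have "g ^^ m = zeta_mult"
      by (simp add: rotation funpow_mult zeta_mult_pow_dvd)
    with fixed[of m] have fix1: "zeta_mult v = v" by simp
    obtain x y z w where v: "v = (x, y, z, w)" by (cases v)
    have eqs: "x = - w" "y = x - w" "z = y - w" "w = z - w"
      using fix1 by (simp_all add: v)
    \<comment> \<open>A vector fixed by \<open>\<zeta>\<close> satisfies \<open>5 w = 0\<close>, and \<open>5\<close> is invertible modulo \<open>3\<close>.\<close>
    have "w = - 4 * w"
      by (subst eqs(4), subst eqs(3), subst eqs(2), subst eqs(1)) simp
    then have "w = 0" using five_times[of w] by simp
    then show ?thesis using eqs by (simp add: v zero_prod_def)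
  next
    case (minus n)
    with fixed[of n] show ?thesis
      by (simp add: eq_uminus_f81)
  qed
qed

interpretation frobenius_complement: fixed_point_free_linear_maps frobenius_complement
proof
  show "id \<in> frobenius_complement"
    unfolding frobenius_complement_def
    by (rule CollectI, rule exI[of _ 0], rule exI[of _ 0]) simp
next
  fix g h assume "g \<in> frobenius_complement" "h \<in> frobenius_complement"
  then show "g \<circ> h \<in> frobenius_complement"
    unfolding frobenius_complement_def using zeta_twist.comp_normal_form by blast
next
  fix g assume g: "g \<in> frobenius_complement"
  have mem: "g ^^ n \<in> frobenius_complement" for n
    using g unfolding frobenius_complement_def using zeta_twist.funpow_normal_form by blast
  show "\<exists>h\<in>frobenius_complement. h \<circ> g = id"
    using frobenius_complement_exponent[OF g]
  proof
    assume "g ^^ 8 = id"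
    then have "g ^^ 7 \<circ> g = id" by (simp flip: funpow_Suc_right)
    then show ?thesis using mem by blast
  next
    assume "g ^^ 10 = id"
    then have "g ^^ 9 \<circ> g = id" by (simp flip: funpow_Suc_right)
    then show ?thesis using mem by blast
  qed
next
  fix g u v assume "g \<in> frobenius_complement"
  then obtain i j where "g = zeta_mult ^^ i \<circ> twist ^^ j"
    by (auto simp: frobenius_complement_def)
  then show "g (u + v) = g u + g v"
    by (simp only: comp_apply funpow_additive[of zeta_mult, OF zeta_mult_add]
        funpow_additive[of twist, OF twist_add])
qed (rule frobenius_complement_fixed_point_free)

section \<open>Infinitely many groups with the spectrum\<close>

lemma spectrum_affine_power:
  "spectrum (affine_power (Suc k) frobenius_complement) = {1, 2, 3, 4, 5, 8, 10}"
proof -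
  define H where "H = affine_power (Suc k) frobenius_complement"
  interpret group H
    unfolding H_def by (rule frobenius_complement.group_affine_power)
  have mem: "zeta_mult ^^ i \<circ> twist ^^ j \<in> frobenius_complement" for i j
    by (auto simp: frobenius_complement_def)
  have pow: "(v, g) [^]\<^bsub>H\<^esub> n = \<one>\<^bsub>H\<^esub> \<longleftrightarrow> g ^^ n = id"
    if "g \<in> frobenius_complement" "g \<noteq> id" for v g and n :: nat
    unfolding H_def by (rule frobenius_complement.affine_power_pow_eq_one_iff) fact+
  have translation: "(v, id) [^]\<^bsub>H\<^esub> (3::nat) = \<one>\<^bsub>H\<^esub>" for v
  proof -
    have "a + a + a = 0" for a :: f81
    proof -
      have "b + b + b = (0::3)" for b
      proof -
        have "b + b + b = 3 * b" by simp
        then show ?thesis by (simp add: three_eq_0)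
      qed
      then show ?thesis by (cases a) (simp add: zero_prod_def)
    qed
    then show ?thesis
      unfolding H_def frobenius_complement.affine_power_pow
      by (simp add: affine_power_simps eval_nat_numeral)
  qed
  let ?e = "(1, 0, 0, 0) :: f81"
  have uminus_neq: "(uminus :: f81 \<Rightarrow> f81) \<noteq> id"
    by (auto dest: fun_cong[of _ _ ?e])
  \<comment> \<open>The map \<open>b\<close> has order \<open>8\<close>, and \<open>\<zeta> b\<^bsup>4\<^esup> = - \<zeta>\<close> has order \<open>10\<close>.\<close>
  let ?y = "zeta_mult ^^ 0 \<circ> twist ^^ 1 :: f81 \<Rightarrow> f81"
  let ?z = "zeta_mult ^^ 1 \<circ> twist ^^ 4 :: f81 \<Rightarrow> f81"
  have y4: "?y ^^ 4 = uminus" by (simp add: twist_pow_4_f81)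
  have y8: "?y ^^ 8 = id"
    using funpow_mult[of 2 4 ?y] by (simp only: y4) (simp add: uminus_funpow_even)
  have z2: "?z ^^ 2 \<noteq> id"
    by (auto simp: twist_pow_4_f81 eval_nat_numeral dest: fun_cong[of _ _ ?e])
  have z5: "?z ^^ 5 = uminus"
  proof -
    have "(twist :: f81 \<Rightarrow> f81) ^^ (4 * 5) = uminus"
      by (simp only: twist_pow_4_f81 flip: funpow_mult) (simp add: uminus_funpow_odd)
    moreover have "(5::nat) dvd 1 * (\<Sum>m<5. (3 ^ 4) ^ m)"
      by (simp add: lessThan_nat_numeral)
    ultimately show ?thesis
      unfolding zeta_twist.funpow_normal_form by (simp only: zeta_mult_pow_dvd id_comp)
  qed
  have z10: "?z ^^ 10 = id"
    using funpow_mult[of 2 5 ?z] by (simp only: z5) (simp add: uminus_funpow_even)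
  have not_id: "g \<noteq> id" if "g ^^ n \<noteq> id" for g :: "f81 \<Rightarrow> f81" and n
    using that by auto
  have y_neq: "?y \<noteq> id" and z_neq: "?z \<noteq> id"
    using not_id[of 4 ?y] not_id[of 2 ?z] y4 uminus_neq z2 by metis+
  have "spectrum H = {1, 2, 3, 4, 5, 8, 10}"
  proof (rule spectrum_3_8_10I)
    fix x assume "x \<in> carrier H"
    then obtain v g where x: "x = (v, g)" and g: "g \<in> frobenius_complement"
      by (auto simp: H_def affine_power_simps)
    show "x [^]\<^bsub>H\<^esub> (3::nat) = \<one>\<^bsub>H\<^esub> \<or> x [^]\<^bsub>H\<^esub> (8::nat) = \<one>\<^bsub>H\<^esub> \<or> x [^]\<^bsub>H\<^esub> (10::nat) = \<one>\<^bsub>H\<^esub>"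
      using frobenius_complement_exponent[OF g] translation[of v] pow[OF g]
      unfolding x by (cases "g = id") blast+
  next
    let ?x = "((\<lambda>_. 0)(0 := ?e), id) :: (nat \<Rightarrow> f81) \<times> (f81 \<Rightarrow> f81)"
    show "?x \<in> carrier H"
      by (simp add: H_def affine_power_simps frobenius_complement.id_mem)
    show "?x [^]\<^bsub>H\<^esub> (3::nat) = \<one>\<^bsub>H\<^esub>" by (rule translation)
    show "?x \<noteq> \<one>\<^bsub>H\<^esub>"
      by (auto simp: H_def affine_power_simps zero_prod_def dest: fun_cong[of _ _ 0])
  next
    show "(\<lambda>_. 0, ?y) \<in> carrier H" "(\<lambda>_. 0, ?z) \<in> carrier H"
      using mem[of 0 1] mem[of 1 4] by (simp_all only: H_def affine_power_simps) simp_all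
    show "(\<lambda>_. 0, ?y) [^]\<^bsub>H\<^esub> (8::nat) = \<one>\<^bsub>H\<^esub>" "(\<lambda>_. 0, ?y) [^]\<^bsub>H\<^esub> (4::nat) \<noteq> \<one>\<^bsub>H\<^esub>"
      unfolding pow[OF mem y_neq] using y8 y4 uminus_neq by simp_all
    show "(\<lambda>_. 0, ?z) [^]\<^bsub>H\<^esub> (10::nat) = \<one>\<^bsub>H\<^esub>" "(\<lambda>_. 0, ?z) [^]\<^bsub>H\<^esub> (5::nat) \<noteq> \<one>\<^bsub>H\<^esub>"
      "(\<lambda>_. 0, ?z) [^]\<^bsub>H\<^esub> (2::nat) \<noteq> \<one>\<^bsub>H\<^esub>"
      unfolding pow[OF mem z_neq] using z10 z5 z2 uminus_neq by simp_all
  qed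
  then show ?thesis by (simp add: H_def)
qed

theorem theorem2:
  assumes "CARD('f::field) = 9"
  shows "nonrecognizable (PGL :: ('f ^ 2 ^ 2) set monoid)"
proof (rule nonrecognizableI)
  fix k
  show "group (affine_power (Suc k) frobenius_complement)"
    by (rule frobenius_complement.group_affine_power)
  show "finite (carrier (affine_power (Suc k) frobenius_complement))"
    by (simp add: affine_power_simps finite_finitely_supported)
  show "spectrum (affine_power (Suc k) frobenius_complement) = spectrum (PGL :: ('f ^ 2 ^ 2) set monoid)"
    by (simp only: spectrum_affine_power spectrum_PGL_2_9[OF assms])
next
  have "frobenius_complement \<noteq> {}"
    using frobenius_complement.id_mem by blast
  moreover have "(1, 0, 0, 0) \<noteq> (0 :: f81)"
    by (simp add: zero_prod_def)
  ultimately show "inj (\<lambda>k. card (carrier (affine_power (Suc k) frobenius_complement)))"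
    by (rule inj_card_affine_power)
qed

end
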